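(* For $n\ge 0$ let $a_n$ be the number of permutations of $\{1,\dots,n\}$ that simultaneously avoid the consecutive patterns $123$, $231$ and $312$ (with $a_0=1$), and let $E(x)=\sum_{n\ge 0}a_n\frac{x^n}{n!}$. Then $$E(x)=1+x(\sec(x)+\tan(x)).$$
   Context: A permutation $\pi=\pi_1\pi_2\cdots\pi_n$ of $\{1,\dots,n\}$ contains the consecutive (dash-free generalized) pattern $\tau=\tau_1\tau_2\tau_3$ if there is an $i$ with $1\le i\le n-2$ such that $\pi_i\pi_{i+1}\pi_{i+2}$ is order-isomorphic to $\tau_1\tau_2\tau_3$. Otherwise $\pi$ avoids $\tau$. *)

theory Defs
  imports
    "HOL-Combinatorics.Multiset_Permutations"
    "HOL-Computational_Algebra.Formal_Power_Series"
begin

definition order_isomorphic :: "nat list \<Rightarrow> nat list \<Rightarrow> bool" where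
  "order_isomorphic u v \<longleftrightarrow> length u = length v \<and>
     (\<forall>j<length u. \<forall>k<length u. u ! j < u ! k \<longleftrightarrow> v ! j < v ! k)"

(* Positions in a list count from 0, so the window at i consists of the
   entries i + 1, ..., i + length t in the usual 1-based numbering. *)
definition contains_consecutive :: "nat list \<Rightarrow> nat list \<Rightarrow> bool" where
  "contains_consecutive p t \<longleftrightarrow>
     (\<exists>i. i + length t \<le> length p \<and> order_isomorphic (take (length t) (drop i p)) t)"

definition avoids_consecutive :: "nat list \<Rightarrow> nat list \<Rightarrow> bool" where
  "avoids_consecutive p t \<longleftrightarrow> \<not> contains_consecutive p t"

(* Permutations of {1..n} in one-line notation. *)
definition avoiders :: "nat list set \<Rightarrow> nat \<Rightarrow> nat list set" where
  "avoiders T n = {p \<in> permutations_of_set {1..n}. \<forall>t\<in>T. avoids_consecutive p t}"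

definition num_avoiders :: "nat list set \<Rightarrow> nat \<Rightarrow> nat" where
  "num_avoiders T n = card (avoiders T n)"

definition egf :: "(nat \<Rightarrow> nat) \<Rightarrow> real fps" where
  "egf a = Abs_fps (\<lambda>n. of_nat (a n) / fact n)"

(* The library has formal power series for sin, cos and tan, but not for sec.
   As with fps_tan, the parameter c gives the series of sec (c x). *)
definition fps_sec :: "real \<Rightarrow> real fps" where
  "fps_sec c = 1 / fps_cos c"

end

theory Submission
  imports Defs
begin

text \<open>
  A window with distinct entries avoids 123, 231 and 312 iff it is order isomorphic to one of 321,
  213, 132, that is, iff its entries run downwards in the cyclic order. So the avoiders are invariant
  under cyclic rotation of the values. After deleting the first entry \<open>a\<close> of an arrangement
  \<open>a, b, c, \<dots>\<close>, only the cyclic distance from \<open>b\<close> to \<open>c\<close> matters for what follows, which gives the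
  boustrophedon recurrence of the Entringer numbers \<open>E(n, k)\<close> and \<open>a\<^sub>n = n E(n-1, n-1)\<close>. Iterating the
  recurrence from both ends of a row expands \<open>E(n, k)\<close> in a Newton series whose coefficients are those
  of sine and cosine. At \<open>k = n\<close> this says that the generating function \<open>Z\<close> of the \<open>E(n, n)\<close>
  satisfies \<open>Z = Z sin + cos\<close>, whence \<open>Z = sec + tan\<close>.
\<close>

section \<open>Entringer numbers\<close>

text \<open>The boustrophedon recurrence E(n+1,k+1) = E(n+1,k) + E(n,n-k), summed over k. The range
  of interest is k \<le> n, where \<open>n - i\<close> is never truncated.\<close>

fun entringer :: "nat \<Rightarrow> nat \<Rightarrow> nat" where
  "entringer 0 k = 1"
| "entringer (Suc n) k = (\<Sum>i<k. entringer n (n - i))"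

text \<open>Pascal's rule: advancing k by one in a Newton series adds the series whose coefficients
  are shifted by one.\<close>

lemma binomial_sum_Suc:
  fixes a :: "nat \<Rightarrow> real"
  shows "(\<Sum>j\<le>Suc k. of_nat (Suc k choose j) * a j) =
    (\<Sum>j\<le>k. of_nat (k choose j) * a j) + (\<Sum>j\<le>k. of_nat (k choose j) * a (Suc j))"
proof -
  have "(\<Sum>j\<le>Suc k. of_nat (Suc k choose j) * a j) =
      a 0 + (\<Sum>j\<le>k. of_nat (k choose Suc j) * a (Suc j)) + (\<Sum>j\<le>k. of_nat (k choose j) * a (Suc j))"
    by (simp add: sum.atMost_Suc_shift distrib_right sum.distrib del: sum.atMost_Suc)
  also have "a 0 + (\<Sum>j\<le>k. of_nat (k choose Suc j) * a (Suc j)) =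
      (\<Sum>j\<le>Suc k. of_nat (k choose j) * a j)"
    by (simp add: sum.atMost_Suc_shift del: sum.atMost_Suc)
  also have "\<dots> = (\<Sum>j\<le>k. of_nat (k choose j) * a j)"
    by simp
  finally show ?thesis .
qed

definition sin_coeff_egf :: "nat \<Rightarrow> real" where
  "sin_coeff_egf j = fact j * fps_nth (fps_sin 1) j"

definition cos_coeff_egf :: "nat \<Rightarrow> real" where
  "cos_coeff_egf j = fact j * fps_nth (fps_cos 1) j"

lemma sin_coeff_egf_0 [simp]: "sin_coeff_egf 0 = 0"
  and cos_coeff_egf_0 [simp]: "cos_coeff_egf 0 = 1"
  by (simp_all add: sin_coeff_egf_def cos_coeff_egf_def)

lemma sin_coeff_egf_Suc: "sin_coeff_egf (Suc j) = cos_coeff_egf j"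
proof -
  have "fps_nth (fps_cos (1::real)) j = of_nat (Suc j) * fps_nth (fps_sin 1) (Suc j)"
    using arg_cong[OF fps_sin_deriv[of "1::real"], of "\<lambda>f. fps_nth f j"] by simp
  then show ?thesis
    by (simp add: sin_coeff_egf_def cos_coeff_egf_def)
qed

lemma cos_coeff_egf_Suc: "cos_coeff_egf (Suc j) = - sin_coeff_egf j"
proof -
  have "fps_nth (fps_sin (1::real)) j = - (of_nat (Suc j) * fps_nth (fps_cos 1) (Suc j))"
    using arg_cong[OF fps_cos_deriv[of "1::real"], of "\<lambda>f. fps_nth f j"]
    by (simp add: fps_const_neg[symmetric] del: fps_const_neg)
  then show ?thesis
    by (simp add: sin_coeff_egf_def cos_coeff_egf_def)
qed

text \<open>Both ends of a row are expanded together: forward differences from the left end of row n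
  are values from the right end of row n-1, and conversely with a minus sign. This is the derivative
  pattern of sine and cosine. The \<open>if\<close> terms carry the boundary value E(n-j,0), which
  is 1 in row 0 and 0 in all others.\<close>

lemma entringer_newton:
  assumes "k \<le> n"
  shows "real (entringer n k) = (\<Sum>j\<le>k. of_nat (k choose j) *
           (sin_coeff_egf j * real (entringer (n - j) (n - j)) + (if n = j then cos_coeff_egf j else 0)))
       \<and> real (entringer n (n - k)) = (\<Sum>j\<le>k. of_nat (k choose j) *
           (cos_coeff_egf j * real (entringer (n - j) (n - j)) - (if n = j then sin_coeff_egf j else 0)))"
  using assms
proof (induction k arbitrary: n)
  case 0
  then show ?case by (cases n) auto
next
  case (Suc k)
  then obtain m where n: "n = Suc m" and km: "k \<le> m"
    by (cases n) auto
  have 1: "entringer n (Suc k) = entringer n k + entringer m (m - k)"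
    by (simp add: n)
  \<comment> \<open>The recurrence read from the right end, where \<open>m - k\<close> is
    \<open>n - Suc k\<close>.\<close>
  have "entringer n (Suc (m - k)) = entringer n (m - k) + entringer m (m - (m - k))"
    by (simp add: n)
  then have 2: "real (entringer n (n - Suc k)) = real (entringer n (n - k)) - real (entringer m k)"
    using km by (simp add: n Suc_diff_le)
  have kn: "k \<le> n" using km n by simp
  show ?case
    \<comment> \<open>The unshifted half of each split sum is the expansion in row n; the shifted
      half is the one in row m, because n - Suc j = m - j.\<close>
    unfolding 2 1 of_nat_add
    unfolding Suc.IH[OF kn, THEN conjunct1] Suc.IH[OF kn, THEN conjunct2]
      Suc.IH[OF km, THEN conjunct1] Suc.IH[OF km, THEN conjunct2] binomial_sum_Suc
    unfolding n
    by (auto simp: sin_coeff_egf_Suc cos_coeff_egf_Suc sum_subtractf[symmetric] sum.distrib[symmetric]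
        algebra_simps intro!: sum.cong)
qed

text \<open>At k = n the Newton series is a binomial convolution, hence a product of exponential
  generating functions.\<close>

lemma fps_entringer_diagonal:
  "Abs_fps (\<lambda>n. real (entringer n n) / fact n) = fps_sec 1 + fps_tan 1"
proof -
  define Z where "Z = Abs_fps (\<lambda>n. real (entringer n n) / fact n)"
  have "Z = fps_sin 1 * Z + fps_cos 1"
  proof (rule fps_ext)
    fix n
    have "real (entringer n n) = (\<Sum>j\<le>n. of_nat (n choose j) *
        (sin_coeff_egf j * real (entringer (n - j) (n - j)) + (if n = j then cos_coeff_egf j else 0)))"
      using entringer_newton[of n n] by simp
    also have "\<dots> = (\<Sum>j\<le>n. fact n * (fps_nth (fps_sin 1) j * fps_nth Z (n - j))) +
        (\<Sum>j\<le>n. of_nat (n choose j) * (if n = j then cos_coeff_egf j else 0))"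
      unfolding distrib_left sum.distrib
      by (intro arg_cong2[where f = "(+)"] sum.cong refl)
        (auto simp: Z_def sin_coeff_egf_def binomial_fact field_simps)
    also have "(\<Sum>j\<le>n. of_nat (n choose j) * (if n = j then cos_coeff_egf j else 0)) =
        (\<Sum>j\<le>n. if n = j then cos_coeff_egf n else 0)"
      by (intro sum.cong) auto
    also have "\<dots> = fact n * fps_nth (fps_cos 1) n"
      by (simp add: cos_coeff_egf_def)
    finally have "real (entringer n n) = fact n * fps_nth (fps_sin 1 * Z + fps_cos 1) n"
      by (simp add: fps_mult_nth sum_distrib_left atLeast0AtMost distrib_left)
    then show "fps_nth Z n = fps_nth (fps_sin 1 * Z + fps_cos 1) n"
      by (simp add: Z_def)
  qed
  then have Z: "Z * (1 - fps_sin 1) = fps_cos 1"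
    by (simp add: algebra_simps)
  have sc: "(fps_cos 1)\<^sup>2 + (fps_sin (1::real))\<^sup>2 = 1"
    by (rule fps_sin_cos_sum_of_squares)
  have c0: "fps_nth (fps_cos (1::real)) 0 \<noteq> 0" by simp
  then have cn: "fps_cos (1::real) \<noteq> 0" by (metis fps_zero_nth)
  \<comment> \<open>Multiplying by 1 + sin turns 1 - sin into the square of cos; one nonzero factor
    cos then cancels.\<close>
  have "fps_cos 1 * (Z * fps_cos 1) = Z * (1 - (fps_sin 1)\<^sup>2)"
    using sc by (simp add: power2_eq_square algebra_simps flip: sc)
  also have "\<dots> = Z * (1 - fps_sin 1) * (1 + fps_sin 1)"
    by (simp add: power2_eq_square algebra_simps)
  also have "\<dots> = fps_cos 1 * (1 + fps_sin 1)"
    by (simp add: Z)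
  finally have *: "Z * fps_cos 1 = 1 + fps_sin 1"
    using cn by simp
  have "(fps_sec 1 + fps_tan 1) * fps_cos 1 = 1 + fps_sin (1::real)"
    using c0 by (simp add: fps_sec_def fps_tan_def fps_divide_unit distrib_right mult.assoc
        inverse_mult_eq_1)
  with * have "Z * fps_cos 1 = (fps_sec 1 + fps_tan 1) * fps_cos 1" by simp
  with cn have "Z = fps_sec 1 + fps_tan 1" by simp
  then show ?thesis by (simp add: Z_def)
qed

section \<open>Cyclic order\<close>

text \<open>Going down from \<open>a\<close>, and wrapping from the bottom to the top, one meets
  \<open>b\<close> before \<open>c\<close>. The disjuncts are the patterns 321, 132 and 213.\<close>

definition cyc_desc :: "nat \<Rightarrow> nat \<Rightarrow> nat \<Rightarrow> bool" where
  "cyc_desc a b c \<longleftrightarrow> a > b \<and> b > c \<or> b > c \<and> c > a \<or> c > a \<and> a > b"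

lemma cyc_desc_rotate: "cyc_desc a b c \<longleftrightarrow> cyc_desc b c a"
  by (auto simp: cyc_desc_def)

lemma cyc_desc_trans: "cyc_desc a b c \<Longrightarrow> cyc_desc a c d \<Longrightarrow> cyc_desc a b d"
  by (auto simp: cyc_desc_def)

lemma cyc_desc_distinct: "cyc_desc a b c \<Longrightarrow> a \<noteq> b \<and> b \<noteq> c \<and> a \<noteq> c"
  by (auto simp: cyc_desc_def)

text \<open>Ranks run through 0, ..., card X - 1 once each; inserting a new maximum leaves the other
  ranks unchanged.\<close>

lemma sum_card_below:
  fixes X :: "nat set"
  assumes "finite X"
  shows "(\<Sum>x\<in>X. f (card {y \<in> X. y < x})) = (\<Sum>i<card X. f i)"
  using assms
proof (induction X rule: finite_linorder_max_induct)
  case empty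
  then show ?case by simp
next
  case (insert b A)
  then have b: "b \<notin> A" by auto
  have 1: "{y \<in> insert b A. y < b} = A" using insert by auto
  have 2: "{y \<in> insert b A. y < x} = {y \<in> A. y < x}" if "x \<in> A" for x
    using insert that by auto
  have "(\<Sum>x\<in>insert b A. f (card {y \<in> insert b A. y < x})) =
      f (card {y \<in> insert b A. y < b}) + (\<Sum>x\<in>A. f (card {y \<in> insert b A. y < x}))"
    using insert.hyps(1) b by (rule sum.insert)
  also have "{y \<in> insert b A. y < b} = A" by (fact 1)
  also have "(\<Sum>x\<in>A. f (card {y \<in> insert b A. y < x})) = (\<Sum>x\<in>A. f (card {y \<in> A. y < x}))"
    by (rule sum.cong) (simp_all only: 2)
  finally show ?case using insert b by (simp add: add.commute)
qed

text \<open>Seen from \<open>b\<close>, the other elements of S are linearly ordered. By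
  \<open>down\<close>, X is an initial segment, so ranks within S are ranks within X.\<close>

lemma sum_card_cyc_between:
  assumes "finite S" "X \<subseteq> S - {b}"
    and down: "\<And>c e. c \<in> X \<Longrightarrow> e \<in> S \<Longrightarrow> cyc_desc b e c \<Longrightarrow> e \<in> X"
  shows "(\<Sum>c\<in>X. f (card {e \<in> S. cyc_desc b e c})) = (\<Sum>i<card X. f i)"
proof -
  obtain M where M: "\<And>x. x \<in> S \<Longrightarrow> x < M"
    using finite_nat_set_iff_bounded assms(1) by metis
  \<comment> \<open>the cyclic order cut open at \<open>b\<close>\<close>
  define g where "g x = (if x \<le> b then b - x else b + M - x)" for x
  \<comment> \<open>Elements up to \<open>b\<close> get values at most \<open>b\<close>; larger
    ones, being below \<open>M\<close>, get values above \<open>b\<close>.\<close>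
  have g: "cyc_desc b e c \<longleftrightarrow> g e < g c" if "e \<in> S - {b}" "c \<in> S - {b}" for e c
    using M[of e] M[of c] that by (auto simp: g_def cyc_desc_def)
  have inj: "inj_on g X"
  proof (rule inj_onI)
    fix x y assume "x \<in> X" "y \<in> X" "g x = g y"
    then show "x = y"
      using M[of x] M[of y] assms(2) by (auto simp: g_def split: if_splits)
  qed
  have fin: "finite X" using assms finite_subset by blast
  have "card {e \<in> S. cyc_desc b e c} = card {y \<in> g ` X. y < g c}" if c: "c \<in> X" for c
  proof -
    have cS: "c \<in> S - {b}" using c assms(2) by blast
    have "{e \<in> S. cyc_desc b e c} = {e \<in> X. g e < g c}"
    proof (intro equalityI subsetI)
      fix e assume e: "e \<in> {e \<in> S. cyc_desc b e c}"
      then have "e \<in> S - {b}" using cyc_desc_distinct[of b e c] by auto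
      then show "e \<in> {e \<in> X. g e < g c}" using e down[OF c, of e] g[OF _ cS, of e] by simp
    next
      fix e assume e: "e \<in> {e \<in> X. g e < g c}"
      then have "e \<in> S - {b}" using assms(2) by blast
      then show "e \<in> {e \<in> S. cyc_desc b e c}" using e g[OF _ cS, of e] by simp
    qed
    moreover have "{y \<in> g ` X. y < g c} = g ` {e \<in> X. g e < g c}" by auto
    moreover have "inj_on g {e \<in> X. g e < g c}" using inj by (rule inj_on_subset) auto
    ultimately show ?thesis by (simp add: card_image)
  qed
  then have "(\<Sum>c\<in>X. f (card {e \<in> S. cyc_desc b e c})) = (\<Sum>c\<in>X. f (card {y \<in> g ` X. y < g c}))"
    by simp
  also have "\<dots> = (\<Sum>x\<in>g ` X. f (card {y \<in> g ` X. y < x}))"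
    by (simp add: sum.reindex[OF inj])
  also have "\<dots> = (\<Sum>i<card X. f i)"
    using sum_card_below[of "g ` X" f] fin by (simp add: card_image[OF inj])
  finally show ?thesis .
qed

text \<open>Each element other than \<open>b\<close> and \<open>c\<close> lies on exactly one of the
  two arcs that they bound.\<close>

lemma card_cyc_beyond:
  assumes "finite S" "b \<in> S" "c \<in> S" "b \<noteq> c"
  shows "card {e \<in> S. cyc_desc b c e} = card S - 2 - card {e \<in> S. cyc_desc b e c}"
proof -
  have "{e \<in> S. cyc_desc b c e} = (S - {b, c}) - {e \<in> S. cyc_desc b e c}"
    using assms by (auto simp: cyc_desc_def)
  moreover have "{e \<in> S. cyc_desc b e c} \<subseteq> S - {b, c}"
    by (auto simp: cyc_desc_def)
  moreover have "card (S - {b, c}) = card S - 2"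
    using assms by (simp add: card_Diff_subset)
  ultimately show ?thesis
    using assms by (simp add: card_Diff_subset)
qed

section \<open>Cyclically descending arrangements\<close>

fun cyc_descending :: "nat list \<Rightarrow> bool" where
  "cyc_descending (a # b # c # xs) \<longleftrightarrow> cyc_desc a b c \<and> cyc_descending (b # c # xs)"
| "cyc_descending _ \<longleftrightarrow> True"

text \<open>Two leading entries are fixed because together they constrain the third; only the tail
  is recorded.\<close>

definition arrangements :: "nat set \<Rightarrow> nat \<Rightarrow> nat \<Rightarrow> nat list set" where
  "arrangements S a b = {xs. a # b # xs \<in> permutations_of_set S \<and> cyc_descending (a # b # xs)}"

lemma finite_arrangements: "finite (arrangements S a b)"
proof -
  have "(\<lambda>xs. a # b # xs) ` arrangements S a b \<subseteq> permutations_of_set S"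
    by (auto simp: arrangements_def)
  then have "finite ((\<lambda>xs. a # b # xs) ` arrangements S a b)"
    by (rule finite_subset) simp
  then show ?thesis by (rule finite_imageD) (auto intro: inj_onI)
qed

text \<open>The entry \<open>a\<close> constrains only the third entry \<open>c\<close>; what
  follows is governed by \<open>b\<close> and \<open>c\<close>. Three elements ensure that
  \<open>c\<close> exists.\<close>

lemma arrangements_rec:
  assumes "a \<in> S" "b \<in> S" "a \<noteq> b" "card S \<ge> 3"
  shows "arrangements S a b = (\<Union>c\<in>{c \<in> S. cyc_desc a b c}. (#) c ` arrangements (S - {a}) b c)"
    (is "_ = ?R")
proof (intro equalityI subsetI)
  fix xs assume xs: "xs \<in> arrangements S a b"
  then have S: "set (a # b # xs) = S" "distinct (a # b # xs)"
    by (auto simp: arrangements_def permutations_of_set_def)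
  then have "length (a # b # xs) \<ge> 3"
    using distinct_card[of "a # b # xs"] assms by simp
  then obtain c ys where "xs = c # ys" by (cases xs) auto
  then show "xs \<in> ?R" using xs by (auto simp: arrangements_def permutations_of_set_def)
next
  fix xs assume "xs \<in> ?R"
  then obtain c ys where c: "cyc_desc a b c" and ys: "ys \<in> arrangements (S - {a}) b c"
    and xs: "xs = c # ys"
    by blast
  from ys have set: "set (b # c # ys) = S - {a}" and dist: "distinct (b # c # ys)"
    and desc: "cyc_descending (b # c # ys)"
    by (simp_all only: arrangements_def permutations_of_set_def mem_Collect_eq)
  have "set (a # b # xs) = insert a (set (b # c # ys))"
    by (simp add: xs)
  also have "\<dots> = S"
    using assms(1) by (simp only: set insert_Diff)
  finally have "set (a # b # xs) = S" .
  moreover have "a \<notin> set (b # c # ys)"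
    by (simp only: set) simp
  then have "distinct (a # b # xs)"
    using dist by (simp add: xs)
  moreover have "cyc_descending (a # b # xs)"
    using c desc by (simp add: xs)
  ultimately show "xs \<in> arrangements S a b"
    unfolding arrangements_def permutations_of_set_def by blast
qed

text \<open>Only the number of admissible third entries matters. Seen from \<open>b\<close>, these
  have ranks 0, 1, ...; one of rank i leaves m - i admissible successors, which is the recurrence of
  \<open>entringer\<close>.\<close>

lemma card_arrangements:
  assumes "finite S" "a \<in> S" "b \<in> S" "a \<noteq> b" "card S = Suc (Suc m)"
  shows "card (arrangements S a b) = entringer m (card {c \<in> S. cyc_desc a b c})"
  using assms
proof (induction m arbitrary: S a b)
  case 0
  then have S: "S = {a, b}"
    by (metis card_2_iff insertE numeral_2_eq_2 singletonD doubleton_eq_iff)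
  have "xs = []" if "distinct (a # b # xs)" "set (a # b # xs) = {a, b}" for xs
    using that by (cases xs) auto
  then have "arrangements S a b = {[]}"
    using 0 by (auto simp: arrangements_def permutations_of_set_def S)
  then show ?case by simp
next
  case (Suc m)
  define C where "C = {c \<in> S. cyc_desc a b c}"
  have card': "card (S - {a}) = Suc (Suc m)" using Suc.prems by simp
  have C: "c \<in> S - {a}" "b \<noteq> c" if "c \<in> C" for c
    using that by (auto simp: C_def cyc_desc_def)
  have "card (arrangements S a b) = card (\<Union>c\<in>C. (#) c ` arrangements (S - {a}) b c)"
    using arrangements_rec[of a S b] Suc.prems by (simp add: C_def)
  also have "\<dots> = (\<Sum>c\<in>C. card ((#) c ` arrangements (S - {a}) b c))"
    using Suc.prems by (intro card_UN_disjoint) (auto simp: C_def finite_arrangements)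
  also have "\<dots> = (\<Sum>c\<in>C. card (arrangements (S - {a}) b c))"
    by (simp add: card_image)
  also have "\<dots> = (\<Sum>c\<in>C. entringer m (m - card {e \<in> S - {a}. cyc_desc b e c}))"
  proof (intro sum.cong refl)
    fix c assume c: "c \<in> C"
    have "card (arrangements (S - {a}) b c) = entringer m (card {e \<in> S - {a}. cyc_desc b c e})"
      using Suc.prems C[OF c] card' by (intro Suc.IH) auto
    also have "card {e \<in> S - {a}. cyc_desc b c e} = m - card {e \<in> S - {a}. cyc_desc b e c}"
      using card_cyc_beyond[of "S - {a}" b c] Suc.prems C[OF c] card' by simp
    finally show "card (arrangements (S - {a}) b c) =
        entringer m (m - card {e \<in> S - {a}. cyc_desc b e c})" .
  qed
  also have "\<dots> = (\<Sum>i<card C. entringer m (m - i))"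
  proof (rule sum_card_cyc_between)
    \<comment> \<open>After rotation, C is the arc going down from \<open>b\<close> to
      \<open>a\<close>, so it is closed under moving towards \<open>b\<close>.\<close>
    show "e \<in> C" if "c \<in> C" "e \<in> S - {a}" "cyc_desc b e c" for c e
      using that cyc_desc_trans[of b e c a] by (auto simp: C_def cyc_desc_rotate[of a b])
  qed (use Suc.prems C in auto)
  finally show ?case by (simp add: C_def)
qed

text \<open>For a fixed first entry the second is free, so its cyclic ranks run through 0, ..., k.
  Their sum is one full row of the recurrence, the same for each first entry.\<close>

lemma card_cyc_descending_permutations:
  assumes "finite S" "card S = Suc m"
  shows "card {p \<in> permutations_of_set S. cyc_descending p} = Suc m * entringer m m"
proof (cases m)
  case 0
  then obtain x where "S = {x}" using assms card_1_singletonE by auto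
  then have "{p \<in> permutations_of_set S. cyc_descending p} = {[x]}" by auto
  then show ?thesis using 0 by simp
next
  case (Suc k)
  let ?I = "Sigma S (\<lambda>a. S - {a})"
  let ?F = "\<lambda>(a, b). (\<lambda>xs. a # b # xs) ` arrangements S a b"
  have eq: "{p \<in> permutations_of_set S. cyc_descending p} = (\<Union>ab\<in>?I. ?F ab)"
  proof (intro equalityI subsetI)
    fix p assume p: "p \<in> {p \<in> permutations_of_set S. cyc_descending p}"
    then have "length p = Suc (Suc k)"
      using assms Suc distinct_card[of p] by (auto simp: permutations_of_set_def)
    then obtain a b xs where "p = a # b # xs" by (auto simp: length_Suc_conv)
    then show "p \<in> (\<Union>ab\<in>?I. ?F ab)"
      using p by (auto simp: arrangements_def permutations_of_set_def)
  qed (auto simp: arrangements_def)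
  have "card {p \<in> permutations_of_set S. cyc_descending p} = (\<Sum>ab\<in>?I. card (?F ab))"
    unfolding eq using assms by (intro card_UN_disjoint) (auto simp: finite_arrangements)
  also have "\<dots> = (\<Sum>(a, b)\<in>?I. card (arrangements S a b))"
    by (intro sum.cong refl) (auto simp: card_image inj_on_def)
  also have "\<dots> = (\<Sum>a\<in>S. \<Sum>b\<in>S - {a}. card (arrangements S a b))"
    using assms by (subst sum.Sigma) auto
  also have "\<dots> = (\<Sum>a\<in>S. entringer m m)"
  proof (intro sum.cong refl)
    fix a assume a: "a \<in> S"
    have "(\<Sum>b\<in>S - {a}. card (arrangements S a b)) =
        (\<Sum>b\<in>S - {a}. entringer k (k - card {e \<in> S. cyc_desc a e b}))"
      using assms a Suc
      by (intro sum.cong refl) (auto simp: card_arrangements[where m = k] card_cyc_beyond)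
    also have "\<dots> = (\<Sum>i<card (S - {a}). entringer k (k - i))"
      using assms
      by (intro sum_card_cyc_between) (auto simp: cyc_desc_def)
    also have "\<dots> = entringer m m" using assms a Suc by simp
    finally show "(\<Sum>b\<in>S - {a}. card (arrangements S a b)) = entringer m m" .
  qed
  finally show ?thesis using assms by simp
qed

section \<open>Avoidance\<close>

lemma cyc_descending_iff_nth:
  "cyc_descending p \<longleftrightarrow> (\<forall>i. i + 3 \<le> length p \<longrightarrow> cyc_desc (p ! i) (p ! Suc i) (p ! Suc (Suc i)))"
proof (induction p rule: cyc_descending.induct)
  case (1 a b c xs)
  have "(\<forall>i. P i) \<longleftrightarrow> P 0 \<and> (\<forall>i. P (Suc i))" for P
    by (metis nat.exhaust)
  from this[of "\<lambda>i. i + 3 \<le> length (a # b # c # xs) \<longrightarrow>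
      cyc_desc ((a # b # c # xs) ! i) ((a # b # c # xs) ! Suc i) ((a # b # c # xs) ! Suc (Suc i))"]
  show ?case using 1 by simp
qed auto

lemma contains_consecutive_3:
  assumes "length t = 3"
  shows "contains_consecutive p t \<longleftrightarrow>
    (\<exists>i. i + 3 \<le> length p \<and> order_isomorphic [p ! i, p ! Suc i, p ! Suc (Suc i)] t)"
proof -
  have "take 3 (drop i p) = [p ! i, p ! Suc i, p ! Suc (Suc i)]" if "i + 3 \<le> length p" for i
    using that by (simp add: list_eq_iff_nth_eq less_Suc_eq numeral_3_eq_3 nth_Cons')
  then show ?thesis
    using assms by (auto simp: contains_consecutive_def)
qed

text \<open>The six orders of three distinct entries form two cyclic classes, the rotations of 321
  and those of 123.\<close>

lemma cyc_desc_iff_order_isomorphic: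
  assumes "distinct [a, b, c]"
  shows "cyc_desc a b c \<longleftrightarrow>
    (\<forall>t\<in>{[1, 2, 3], [2, 3, 1], [3, 1, 2]}. \<not> order_isomorphic [a, b, c] t)"
  using assms
  by (auto simp: cyc_desc_def order_isomorphic_def All_less_Suc)

lemma avoids_iff_cyc_descending:
  assumes "distinct p"
  shows "(\<forall>t\<in>{[1, 2, 3], [2, 3, 1], [3, 1, 2]}. avoids_consecutive p t) \<longleftrightarrow> cyc_descending p"
proof -
  have "distinct [p ! i, p ! Suc i, p ! Suc (Suc i)]" if "i + 3 \<le> length p" for i
    using that assms by (simp add: nth_eq_iff_index_eq)
  then show ?thesis
    unfolding cyc_descending_iff_nth
    by (auto simp: avoids_consecutive_def contains_consecutive_3 cyc_desc_iff_order_isomorphic)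
qed

lemma num_avoiders_eq:
  "num_avoiders {[1, 2, 3], [2, 3, 1], [3, 1, 2]} n =
    (case n of 0 \<Rightarrow> 1 | Suc m \<Rightarrow> Suc m * entringer m m)"
proof -
  have "avoiders {[1, 2, 3], [2, 3, 1], [3, 1, 2]} n =
      {p \<in> permutations_of_set {1..n}. cyc_descending p}"
    unfolding avoiders_def
    by (intro Collect_cong conj_cong refl avoids_iff_cyc_descending)
      (simp add: permutations_of_set_def)
  moreover have "{p \<in> permutations_of_set {1..0::nat}. cyc_descending p} = {[]}"
    by auto
  ultimately show ?thesis
    by (auto simp: num_avoiders_def card_cyc_descending_permutations split: nat.split)
qed

theorem theorem1:
  shows "egf (num_avoiders {[1, 2, 3], [2, 3, 1], [3, 1, 2]}) = 1 + fps_X * (fps_sec 1 + fps_tan 1)"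
  unfolding fps_entringer_diagonal[symmetric]
proof (rule fps_ext)
  fix n
  show "fps_nth (egf (num_avoiders {[1, 2, 3], [2, 3, 1], [3, 1, 2]})) n =
      fps_nth (1 + fps_X * Abs_fps (\<lambda>n. real (entringer n n) / fact n)) n"
    unfolding egf_def num_avoiders_eq
    \<comment> \<open>The factor \<open>Suc m\<close> cancels against \<open>fact (Suc m)\<close>,
      and \<open>fps_X\<close> accounts for the index shift; \<open>of_nat_Suc\<close> and
      \<open>mult_Suc\<close> would break up that factor.\<close>
    by (cases n) (simp_all del: of_nat_Suc mult_Suc)
qed

end
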